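(* $\chi(G^2)=\Delta(G)+1$ for every interval graph $G$.
   Context: All graphs are finite and simple. $\Delta(G)$ is the maximum degree of $G$ and $\chi$ denotes the chromatic number. The square $G^2$ is the graph on $V(G)$ in which two distinct vertices are adjacent iff their distance in $G$ is at most $2$. $G$ is an interval graph if each vertex $v$ can be assigned a closed interval $I_v$ of the real line so that distinct $u,v$ are adjacent iff $I_u\cap I_v\ne\emptyset$. *)

theory Defs
  imports "Graph_Theory.Graph_Theory"
begin

text \<open>
  Finite simple graphs are the locale \<^locale>\<open>graph\<close>: finite, loop-free, symmetric digraphs without
  parallel arcs, an edge being represented by its two opposite arcs. In such a digraph
  \<^const>\<open>out_degree\<close> is the number of neighbours of a vertex.
\<close>

text \<open>Meaningful for finite graphs with at least one vertex.\<close>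
definition max_degree :: "('a,'b) pre_digraph \<Rightarrow> nat" where
  "max_degree G = Max (out_degree G ` verts G)"

text \<open>
  Distance is the shortest-path weight for unit arc weights; it is infinite between vertices in
  different components.
\<close>
definition graph_dist :: "('a,'b) pre_digraph \<Rightarrow> 'a \<Rightarrow> 'a \<Rightarrow> ereal" where
  "graph_dist G u v = wf_digraph.\<mu> G (\<lambda>_. 1) u v"

definition graph_square :: "('a,'b) pre_digraph \<Rightarrow> ('a, 'a \<times> 'a) pre_digraph" where
  "graph_square G =
    \<lparr> verts = verts G,
      arcs = {(u, v). u \<in> verts G \<and> v \<in> verts G \<and> u \<noteq> v \<and> graph_dist G u v \<le> 2},
      tail = fst, head = snd \<rparr>"

definition proper_coloring :: "('a,'b) pre_digraph \<Rightarrow> nat \<Rightarrow> ('a \<Rightarrow> nat) \<Rightarrow> bool" where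
  "proper_coloring G k c \<longleftrightarrow>
    (\<forall>v\<in>verts G. c v < k) \<and> (\<forall>u\<in>verts G. \<forall>v\<in>verts G. u \<rightarrow>\<^bsub>G\<^esub> v \<longrightarrow> c u \<noteq> c v)"

text \<open>The minimum is attained for every finite loop-free graph: give all vertices distinct colours.\<close>
definition chromatic_number :: "('a,'b) pre_digraph \<Rightarrow> nat" where
  "chromatic_number G = (LEAST k. \<exists>c. proper_coloring G k c)"

text \<open>The vertex \<open>v\<close> is assigned the nonempty closed interval from \<open>l v\<close> to \<open>r v\<close>.\<close>
definition interval_graph :: "('a,'b) pre_digraph \<Rightarrow> bool" where
  "interval_graph G \<longleftrightarrow>
    (\<exists>l r :: 'a \<Rightarrow> real.
      (\<forall>v\<in>verts G. l v \<le> r v) \<and>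
      (\<forall>u\<in>verts G. \<forall>v\<in>verts G. u \<noteq> v \<longrightarrow>
        (u \<rightarrow>\<^bsub>G\<^esub> v \<longleftrightarrow> {l u..r u} \<inter> {l v..r v} \<noteq> {})))"

end

theory Submission
  imports Defs
begin

text \<open>
  The lower bound comes from a closed neighbourhood, which is a clique in the square. For the upper
  bound, colour the square greedily by increasing left endpoints. When \<open>v\<close> is coloured, let \<open>w\<close> be
  the interval that starts leftmost among those containing the left endpoint of \<open>v\<close>. If \<open>u\<close> starts
  no later than \<open>v\<close> and is within distance \<open>2\<close> of it, then \<open>u\<close> lies in the closed neighbourhood
  of \<open>w\<close>: either \<open>u\<close> contains the left endpoint of \<open>v\<close> as \<open>w\<close> does, or a common neighbour of \<open>u\<close>
  and \<open>v\<close> contains it and \<open>w\<close> starts at least as far to the left. Since \<open>v\<close> is in that closed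
  neighbourhood as well, at most \<open>\<Delta>(G)\<close> colours are forbidden for \<open>v\<close>.
\<close>

text \<open>Vertices are inserted by increasing \<open>f\<close>. The new vertex \<open>x\<close>
  has maximal \<open>f\<close>, so all its earlier neighbours are among the fewer than
  \<open>k\<close> vertices counted for \<open>x\<close>, and some colour below \<open>k\<close> is
  left over.\<close>

lemma greedy_coloring:
  fixes f :: "'a \<Rightarrow> 'b::linorder" and E :: "'a \<Rightarrow> 'a \<Rightarrow> bool"
  assumes "finite V"
    and "\<And>u v. E u v \<Longrightarrow> E v u"
    and "\<And>v. v \<in> V \<Longrightarrow> card {u\<in>V. u \<noteq> v \<and> f u \<le> f v \<and> E u v} < k"
  shows "\<exists>c::'a \<Rightarrow> nat. (\<forall>v\<in>V. c v < k) \<and> (\<forall>u\<in>V. \<forall>v\<in>V. u \<noteq> v \<longrightarrow> E u v \<longrightarrow> c u \<noteq> c v)"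
  using assms(1,3)
proof (induction V rule: finite_ranking_induct[where f = f])
  case empty
  then show ?case by simp
next
  case (insert x S)
  have "card {u\<in>S. u \<noteq> v \<and> f u \<le> f v \<and> E u v} < k" if "v \<in> S" for v
  proof -
    have "card {u\<in>S. u \<noteq> v \<and> f u \<le> f v \<and> E u v}
        \<le> card {u\<in>insert x S. u \<noteq> v \<and> f u \<le> f v \<and> E u v}"
      using \<open>finite S\<close> by (intro card_mono) auto
    then show ?thesis
      using insert.prems[of v] that by simp
  qed
  then obtain c :: "'a \<Rightarrow> nat" where c: "\<forall>v\<in>S. c v < k"
      "\<forall>u\<in>S. \<forall>v\<in>S. u \<noteq> v \<longrightarrow> E u v \<longrightarrow> c u \<noteq> c v"
    using insert.IH by blast
  define N where "N = {u\<in>S. u \<noteq> x \<and> E u x}"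
  have "N = {u\<in>insert x S. u \<noteq> x \<and> f u \<le> f x \<and> E u x}"
    using insert.hyps by (auto simp: N_def)
  then have "card N < k"
    using insert.prems[of x] by simp
  moreover have "finite N"
    using \<open>finite S\<close> by (simp add: N_def)
  ultimately have "card (c ` N) < card {..<k}"
    using card_image_le[of N c] by simp
  then have "\<not> {..<k} \<subseteq> c ` N"
    using \<open>finite N\<close> by (meson card_mono finite_imageI not_less)
  then obtain a where a: "a < k" "a \<notin> c ` N"
    by auto
  show ?case
  proof (intro exI[of _ "c(x := a)"] conjI ballI impI)
    fix v assume "v \<in> insert x S"
    then show "(c(x := a)) v < k"
      using a c(1) by auto
  next
    fix u v assume uv: "u \<in> insert x S" "v \<in> insert x S" "u \<noteq> v" "E u v"
    \<comment> \<open>\<open>N\<close> collects only those \<open>u\<close> with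
      \<open>E u x\<close>; symmetry of \<open>E\<close> covers edges leaving
      \<open>x\<close>.\<close>
    consider "u = x" "v \<in> N" | "v = x" "u \<in> N" | "u \<in> S" "v \<in> S" "u \<noteq> x" "v \<noteq> x"
      using uv assms(2)[OF uv(4)] by (auto simp: N_def)
    then show "(c(x := a)) u \<noteq> (c(x := a)) v"
    proof cases
      case 3
      then show ?thesis using c(2) uv by simp
    qed (use a uv in \<open>auto simp: N_def\<close>)
  qed
qed

text \<open>For the lower bound: a proper colouring is injective on a clique.\<close>

lemma proper_coloring_clique_le:
  assumes "proper_coloring G k c" "C \<subseteq> verts G"
    and "\<And>u v. u \<in> C \<Longrightarrow> v \<in> C \<Longrightarrow> u \<noteq> v \<Longrightarrow> u \<rightarrow>\<^bsub>G\<^esub> v"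
  shows "card C \<le> k"
proof -
  have "inj_on c C"
    using assms unfolding proper_coloring_def by (intro inj_onI) blast
  moreover have "c ` C \<subseteq> {..<k}"
    using assms(1,2) by (auto simp: proper_coloring_def)
  ultimately show ?thesis
    using card_inj_on_le[of c C "{..<k}"] by simp
qed

lemma (in wf_digraph) graph_dist_le_2_iff:
  assumes "u \<in> verts G" "v \<in> verts G" "u \<noteq> v"
  shows "graph_dist G u v \<le> 2 \<longleftrightarrow> u \<rightarrow>\<^bsub>G\<^esub> v \<or> (\<exists>w. u \<rightarrow>\<^bsub>G\<^esub> w \<and> w \<rightarrow>\<^bsub>G\<^esub> v)"
proof
  assume "graph_dist G u v \<le> 2"
  \<comment> \<open>The bound is relaxed to a strict one because an infimum strictly below 3 has a
    walk of cost below 3 as witness. Costs are lengths, so this walk has at most two arcs.\<close>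
  then have "(INF p\<in>{p. awalk u p v}. ereal (awalk_cost (\<lambda>_. 1) p)) < 3"
    unfolding graph_dist_def \<mu>_def by (rule le_less_trans) simp
  then obtain p where p: "awalk u p v" "ereal (awalk_cost (\<lambda>_. 1) p) < 3"
    unfolding INF_less_iff by blast
  have "awalk_cost (\<lambda>_. 1) p = real (length p)"
    by (simp add: awalk_cost_def sum_list_triv)
  then have "length p < 3"
    using p(2) by simp
  then consider "p = []" | a where "p = [a]" | a b where "p = [a, b]"
    by (cases p; cases "tl p"; cases "tl (tl p)") auto
  then show "u \<rightarrow>\<^bsub>G\<^esub> v \<or> (\<exists>w. u \<rightarrow>\<^bsub>G\<^esub> w \<and> w \<rightarrow>\<^bsub>G\<^esub> v)"
    using p(1) \<open>u \<noteq> v\<close>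
    by cases (auto simp: awalk_simps arcs_ends_conv)
next
  assume "u \<rightarrow>\<^bsub>G\<^esub> v \<or> (\<exists>w. u \<rightarrow>\<^bsub>G\<^esub> w \<and> w \<rightarrow>\<^bsub>G\<^esub> v)"
  then obtain p where "awalk u p v" "awalk_cost (\<lambda>_. 1) p \<le> 2"
  proof (elim disjE exE conjE)
    assume "u \<rightarrow>\<^bsub>G\<^esub> v"
    then obtain a where "a \<in> arcs G" "tail G a = u" "head G a = v" by auto
    then show ?thesis
      using assms by (intro that[of "[a]"]) (auto simp: awalk_simps)
  next
    fix w assume "u \<rightarrow>\<^bsub>G\<^esub> w" "w \<rightarrow>\<^bsub>G\<^esub> v"
    then obtain a b where "a \<in> arcs G" "tail G a = u" "head G a = w"
        "b \<in> arcs G" "tail G b = w" "head G b = v"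
      by (metis reachableE)
    then show ?thesis
      using assms by (intro that[of "[a, b]"]) (auto simp: awalk_simps)
  qed
  then have "graph_dist G u v \<le> ereal (awalk_cost (\<lambda>_. 1) p)" "ereal (awalk_cost (\<lambda>_. 1) p) \<le> 2"
    unfolding graph_dist_def by (auto intro: min_cost_le_walk_cost)
  then show "graph_dist G u v \<le> 2"
    by (rule order_trans)
qed

text \<open>Out-degree counts arcs; without parallel arcs, \<open>head G\<close> is injective on the
  arcs leaving \<open>v\<close>.\<close>

lemma (in nomulti_digraph) out_degree_eq_card_neighbours:
  "out_degree G v = card {u. v \<rightarrow>\<^bsub>G\<^esub> u}"
proof -
  have "inj_on (head G) (out_arcs G v)"
    by (auto simp: inj_on_def arc_to_ends_def intro: no_multi_arcs)
  moreover have "head G ` out_arcs G v = {u. v \<rightarrow>\<^bsub>G\<^esub> u}"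
    by (auto simp: arcs_ends_conv image_iff)
  ultimately show ?thesis
    by (metis card_image out_degree_def)
qed

text \<open>There are no loops, so \<open>v\<close> is not its own neighbour and contributes the
  extra 1.\<close>

lemma (in digraph) card_closed_neighbourhood:
  "finite (insert v {u. v \<rightarrow>\<^bsub>G\<^esub> u})" "card (insert v {u. v \<rightarrow>\<^bsub>G\<^esub> u}) = out_degree G v + 1"
proof -
  have "{u. v \<rightarrow>\<^bsub>G\<^esub> u} \<subseteq> verts G"
    using adj_in_verts by auto
  then have "finite {u. v \<rightarrow>\<^bsub>G\<^esub> u}"
    using finite_verts finite_subset by blast
  then show "finite (insert v {u. v \<rightarrow>\<^bsub>G\<^esub> u})" "card (insert v {u. v \<rightarrow>\<^bsub>G\<^esub> u}) = out_degree G v + 1"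
    using adj_not_same[of v] by (auto simp: out_degree_eq_card_neighbours card_insert_if)
qed

lemma (in wf_digraph) graph_square_adj_iff:
  "u \<rightarrow>\<^bsub>graph_square G\<^esub> v \<longleftrightarrow>
    u \<in> verts G \<and> v \<in> verts G \<and> u \<noteq> v \<and> (u \<rightarrow>\<^bsub>G\<^esub> v \<or> (\<exists>w. u \<rightarrow>\<^bsub>G\<^esub> w \<and> w \<rightarrow>\<^bsub>G\<^esub> v))"
proof -
  have "u \<rightarrow>\<^bsub>graph_square G\<^esub> v \<longleftrightarrow>
      u \<in> verts G \<and> v \<in> verts G \<and> u \<noteq> v \<and> graph_dist G u v \<le> 2"
    by (auto simp: graph_square_def arcs_ends_conv image_iff)
  then show ?thesis
    using graph_dist_le_2_iff by blast
qed

theorem corollary10: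
  fixes G :: "('a, 'b) pre_digraph"
  assumes "graph G" and "verts G \<noteq> {}" and "interval_graph G"
  shows "chromatic_number (graph_square G) = max_degree G + 1"
proof -
  interpret graph G by fact
  let ?S = "graph_square G"
  have adj_sym: "u \<rightarrow>\<^bsub>G\<^esub> v \<Longrightarrow> v \<rightarrow>\<^bsub>G\<^esub> u" for u v
    by (rule arcs_ends_symmetric[OF sym_arcs])
  have degree_le: "out_degree G w \<le> max_degree G" if "w \<in> verts G" for w
    using that by (simp add: max_degree_def)
  obtain l r :: "'a \<Rightarrow> real" where lr: "\<And>v. v \<in> verts G \<Longrightarrow> l v \<le> r v"
    and adj: "\<And>u v. u \<in> verts G \<Longrightarrow> v \<in> verts G \<Longrightarrow> u \<noteq> v \<Longrightarrow>
      u \<rightarrow>\<^bsub>G\<^esub> v \<longleftrightarrow> {l u..r u} \<inter> {l v..r v} \<noteq> {}"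
    using \<open>interval_graph G\<close> unfolding interval_graph_def by blast
  have adj: "u \<rightarrow>\<^bsub>G\<^esub> v \<longleftrightarrow> l u \<le> r v \<and> l v \<le> r u"
    if "u \<in> verts G" "v \<in> verts G" "u \<noteq> v" for u v
    using adj[OF that] lr[OF that(1)] lr[OF that(2)] by auto
  have "card {u\<in>verts G. u \<noteq> v \<and> l u \<le> l v \<and> u \<rightarrow>\<^bsub>?S\<^esub> v} < max_degree G + 1"
    if v: "v \<in> verts G" for v
  proof -
    define A where "A = {u\<in>verts G. u \<noteq> v \<and> l u \<le> l v \<and> u \<rightarrow>\<^bsub>?S\<^esub> v}"
    define B where "B = {w\<in>verts G. l w \<le> l v \<and> l v \<le> r w}"
    have "finite B" "B \<noteq> {}"
      using v lr by (auto simp: B_def)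
    then obtain w where w: "w \<in> B" and w_min: "\<And>x. x \<in> B \<Longrightarrow> l w \<le> l x"
      using arg_min_if_finite(1)[of B l] arg_min_least[of B _ l] by blast
    have wG: "w \<in> verts G" "l w \<le> l v" "l v \<le> r w"
      using w by (auto simp: B_def)
    have "insert v A \<subseteq> insert w {u. w \<rightarrow>\<^bsub>G\<^esub> u}"
    proof
      fix u assume "u \<in> insert v A"
      then have u: "u \<in> verts G" "l u \<le> l v" "u = v \<or> u \<rightarrow>\<^bsub>?S\<^esub> v"
        using v by (auto simp: A_def)
      \<comment> \<open>The other inequality needed for \<open>u\<close> and \<open>w\<close> to
        meet is immediate: \<open>l u \<le> l v \<le> r w\<close>.\<close>
      have "l w \<le> r u"
      proof (cases "l v \<le> r u")
        case True
        then show ?thesis using wG by simp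
      next
        case False
        \<comment> \<open>Here \<open>u\<close> ends before \<open>v\<close> begins, so the two are
          joined through some \<open>x\<close>. Then \<open>l x \<le> r u < l v \<le> r x\<close>
          puts \<open>x\<close> in \<open>B\<close>, and minimality gives
          \<open>l w \<le> l x \<le> r u\<close>.\<close>
        then have "u \<noteq> v" "\<not> u \<rightarrow>\<^bsub>G\<^esub> v"
          using lr[OF v] adj[OF u(1) v] by auto
        then obtain x where "u \<rightarrow>\<^bsub>G\<^esub> x" "x \<rightarrow>\<^bsub>G\<^esub> v"
          using u(3) graph_square_adj_iff by blast
        moreover from this have "x \<in> verts G" "u \<noteq> x" "x \<noteq> v"
          using adj_in_verts adj_not_same by blast+
        ultimately have "l x \<le> r u" "l v \<le> r x"
          using adj[of u x] adj[of x v] u v by auto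
        then show ?thesis
          using w_min[of x] False \<open>x \<in> verts G\<close> by (auto simp: B_def)
      qed
      then show "u \<in> insert w {u. w \<rightarrow>\<^bsub>G\<^esub> u}"
        using adj[OF wG(1) u(1)] u(2) wG by auto
    qed
    then have "card (insert v A) \<le> out_degree G w + 1"
      by (metis card_closed_neighbourhood card_mono)
    \<comment> \<open>Since \<open>v\<close> is not in \<open>A\<close>, the 1 on the right cancels
      and \<open>card A\<close> is at most the degree of \<open>w\<close>.\<close>
    moreover have "finite A" "v \<notin> A"
      by (auto simp: A_def)
    ultimately have "card A < max_degree G + 1"
      using degree_le[OF wG(1)] by simp
    then show ?thesis by (simp add: A_def)
  qed
  moreover have "u \<rightarrow>\<^bsub>?S\<^esub> v \<Longrightarrow> v \<rightarrow>\<^bsub>?S\<^esub> u" for u v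
    unfolding graph_square_adj_iff using adj_sym by blast
  ultimately obtain c where c: "\<forall>v\<in>verts G. c v < max_degree G + 1"
      "\<forall>u\<in>verts G. \<forall>v\<in>verts G. u \<noteq> v \<longrightarrow> u \<rightarrow>\<^bsub>?S\<^esub> v \<longrightarrow> c u \<noteq> c v"
    using greedy_coloring[of "verts G" "dominates ?S" l "max_degree G + 1"] by auto
  have verts_square: "verts ?S = verts G"
    by (simp add: graph_square_def)
  have "proper_coloring ?S (max_degree G + 1) c"
    unfolding proper_coloring_def verts_square using c by (auto simp: graph_square_adj_iff)
  moreover have "max_degree G + 1 \<le> k" if "proper_coloring ?S k c" for k c
  proof -
    \<comment> \<open>The maximum is attained because \<open>verts G\<close> is finite and
      nonempty.\<close>
    have "max_degree G \<in> out_degree G ` verts G"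
      unfolding max_degree_def using assms(2) by (intro Max_in) auto
    then obtain v where v: "v \<in> verts G" "max_degree G = out_degree G v"
      by blast
    let ?C = "insert v {u. v \<rightarrow>\<^bsub>G\<^esub> u}"
    have C: "?C \<subseteq> verts G"
      using v adj_in_verts by auto
    have "x \<rightarrow>\<^bsub>?S\<^esub> y" if "x \<in> ?C" "y \<in> ?C" "x \<noteq> y" for x y
    proof -
      \<comment> \<open>If neither is \<open>v\<close>, the walk through \<open>v\<close> joins
        them.\<close>
      have "x \<rightarrow>\<^bsub>G\<^esub> y \<or> (\<exists>w. x \<rightarrow>\<^bsub>G\<^esub> w \<and> w \<rightarrow>\<^bsub>G\<^esub> y)"
        using that adj_sym by blast
      then show ?thesis
        unfolding graph_square_adj_iff using that C by blast
    qed
    then have "card ?C \<le> k"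
      using \<open>proper_coloring ?S k c\<close> C verts_square
      by (intro proper_coloring_clique_le[of ?S k c ?C]) simp_all
    then show ?thesis
      using card_closed_neighbourhood(2)[of v] v by simp
  qed
  ultimately show ?thesis
    unfolding chromatic_number_def by (intro Least_equality) auto
qed

end
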